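(* Let $G$ be a connected chordal graph with vertex set $V$. If a maximal clique $C$ of $G$ is simply separated, then there exists a clique tree $T$ of $G$ such that $C$ is an endpoint of $T$. Furthermore, let $S$ be any minimal vertex separator of $G$ which is minimal, with respect to inclusion, in the set of all minimal vertex separators of $G$; if $C$ and $C'$ are two simply separated cliques of $G$ lying in two different connected components of $G(V\setminus S)$ (that is, $C\setminus S\subseteq\Gamma$ and $C'\setminus S\subseteq\Gamma'$ for two distinct connected components $\Gamma\neq\Gamma'$ of $G(V\setminus S)$), then there exists a clique tree $T$ of $G$ such that both $C$ and $C'$ are endpoints of $T$.
   Context: Graphs are finite, simple and undirected. For $V'\subseteq V$, $G(V')$ is the subgraph induced by $V'$. Maximal cliques are regarded as subsets of $V$; $\mathcal C$ is the set of all maximal cliques of $G$. A minimal vertex separator of $G$ is a set $S\subset V$ such that, for some pair of non-adjacent vertices $a,b$, $S$ separates $a$ from $b$ in $G$ and no proper subset of $S$ does; $\mathcal S$ is the set of all minimal vertex separators. A vertex $v$ is simplicial if its set of neighbors is a clique. For $C\in\mathcal C$, $\mathrm{Simp}(C)$ is the set of simplicial vertices of $G$ lying in $C$ and $\mathrm{Sep}(C)=C\setminus\mathrm{Simp}(C)$. A maximal clique $C$ with $\mathrm{Simp}(C)\ne\emptyset$ is called simply separated (or a boundary clique) if there exists a maximal clique $C'\in\mathcal C$ with $\mathrm{Sep}(C)=C\cap C'$. A clique tree of $G$ is a tree $T=(\mathcal C,\mathcal E)$ with node set $\mathcal C$ such that for all $C_1,C_2\in\mathcal C$ and every $C_3\in\mathcal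 C$ on the unique path in $T$ between $C_1$ and $C_2$, $C_1\cap C_2\subseteq C_3$. An endpoint of a tree is a node of degree $1$ (a leaf). *)

theory Defs
  imports "Graph_Theory.Digraph_Component"
begin

text \<open>
  Finite simple undirected graphs are the \<^locale>\<open>graph\<close>s of the library: finite, loop-free digraphs
  without parallel arcs whose arc relation is symmetric, so that an edge uv is the pair of arcs
  (u,v), (v,u).
\<close>

definition is_clique :: "('a,'b) pre_digraph \<Rightarrow> 'a set \<Rightarrow> bool" where
  "is_clique G K \<longleftrightarrow> K \<subseteq> verts G \<and> (\<forall>u\<in>K. \<forall>v\<in>K. u \<noteq> v \<longrightarrow> u \<rightarrow>\<^bsub>G\<^esub> v)"

definition max_cliques :: "('a,'b) pre_digraph \<Rightarrow> 'a set set" where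
  "max_cliques G = {C. is_clique G C \<and> \<not> (\<exists>K. is_clique G K \<and> C \<subset> K)}"

text \<open>
  In a symmetric digraph \<^const>\<open>pre_digraph.cycle\<close> also admits the degenerate closed walks u, v, u of
  length 2. The undirected cycles are exactly the cycles of length at least 3; this is why
  \<^const>\<open>tree\<close> is not usable for the trees below.
\<close>

definition chordal :: "('a,'b) pre_digraph \<Rightarrow> bool" where
  "chordal G \<longleftrightarrow>
     (\<forall>p. pre_digraph.cycle G p \<and> 4 \<le> length p \<longrightarrow>
        (\<exists>u \<in> tail G ` set p. \<exists>v \<in> tail G ` set p. u \<rightarrow>\<^bsub>G\<^esub> v \<and>
           (u, v) \<notin> arc_to_ends G ` set p \<and> (v, u) \<notin> arc_to_ends G ` set p))"

definition undirected_tree :: "('a,'b) pre_digraph \<Rightarrow> bool" where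
  "undirected_tree T \<longleftrightarrow>
     graph T \<and> Digraph_Component.connected T \<and> \<not> (\<exists>p. pre_digraph.cycle T p \<and> 3 \<le> length p)"

text \<open>In a graph the out-degree is the undirected degree.\<close>

definition endpoint :: "('a,'b) pre_digraph \<Rightarrow> 'a \<Rightarrow> bool" where
  "endpoint T x \<longleftrightarrow> x \<in> verts T \<and> out_degree T x = 1"

definition clique_tree :: "('a,'b) pre_digraph \<Rightarrow> ('a set,'c) pre_digraph \<Rightarrow> bool" where
  "clique_tree G T \<longleftrightarrow>
     undirected_tree T \<and> verts T = max_cliques G \<and>
     (\<forall>C1 \<in> max_cliques G. \<forall>C2 \<in> max_cliques G. \<forall>p. pre_digraph.apath T C1 p C2 \<longrightarrow>
        (\<forall>C3 \<in> set (pre_digraph.awalk_verts T C1 p). C1 \<inter> C2 \<subseteq> C3))"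

definition separates :: "('a,'b) pre_digraph \<Rightarrow> 'a set \<Rightarrow> 'a \<Rightarrow> 'a \<Rightarrow> bool" where
  "separates G S a b \<longleftrightarrow>
     S \<subseteq> verts G \<and> a \<in> verts G - S \<and> b \<in> verts G - S \<and> \<not> a \<rightarrow>\<^sup>*\<^bsub>G \<restriction> (verts G - S)\<^esub> b"

definition min_vertex_separators :: "('a,'b) pre_digraph \<Rightarrow> 'a set set" where
  "min_vertex_separators G =
     {S. S \<subset> verts G \<and>
         (\<exists>a \<in> verts G. \<exists>b \<in> verts G. a \<noteq> b \<and> \<not> a \<rightarrow>\<^bsub>G\<^esub> b \<and>
            separates G S a b \<and> (\<forall>S'. S' \<subset> S \<longrightarrow> \<not> separates G S' a b))}"

text \<open>
  For symmetric digraphs the strongly connected components are the connected components; they are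
  given by their vertex sets.
\<close>

definition component_verts :: "('a,'b) pre_digraph \<Rightarrow> 'a set set" where
  "component_verts G = pre_digraph.sccs_verts G"

definition simplicial :: "('a,'b) pre_digraph \<Rightarrow> 'a \<Rightarrow> bool" where
  "simplicial G v \<longleftrightarrow> v \<in> verts G \<and> is_clique G {u. v \<rightarrow>\<^bsub>G\<^esub> u}"

definition Simp :: "('a,'b) pre_digraph \<Rightarrow> 'a set \<Rightarrow> 'a set" where
  "Simp G C = {v \<in> C. simplicial G v}"

definition Sep :: "('a,'b) pre_digraph \<Rightarrow> 'a set \<Rightarrow> 'a set" where
  "Sep G C = C - Simp G C"

definition simply_separated :: "('a,'b) pre_digraph \<Rightarrow> 'a set \<Rightarrow> bool" where
  "simply_separated G C \<longleftrightarrow>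
     C \<in> max_cliques G \<and> Simp G C \<noteq> {} \<and> (\<exists>C' \<in> max_cliques G. Sep G C = C \<inter> C')"

end

theory Submission
  imports Defs
begin

text \<open>
  A clique tree is grown by attaching the maximal cliques one at a time as leaves, a clique C to a
  clique B that contains the intersection of C with all earlier cliques. For a chordal graph such an
  order exists by deletion of simplicial vertices. If C is simply separated, with Sep(C) contained in
  B, then the cliques other than C are the maximal cliques of the subgraph they span, which is again
  chordal; hence C can be attached last, to B. Two simply separated cliques C and C' can both be
  attached last unless one is forced to hang on the other. In that case Sep(C) = C \<inter> C' is a minimal
  vertex separator contained in S, so it is S. If C' has a partner other than C, this partner contains
  S; otherwise some component of G - S avoids C and C', and by minimality of S and chordality it
  contains a vertex adjacent to all of S, hence a third clique containing S.
\<close>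

section \<open>Join trees\<close>

text \<open>The side condition of \<open>attach\<close> is the running intersection property.
  \<open>P\<close> holds both orientations of each edge, as the library's graphs do. The family
  \<open>F\<close> is arbitrary, so that subfamilies of the maximal cliques are covered too.\<close>

inductive join_tree :: "'a set set \<Rightarrow> ('a set \<times> 'a set) set \<Rightarrow> bool" where
  single: "join_tree {A} {}"
| attach: "join_tree F P \<Longrightarrow> C \<notin> F \<Longrightarrow> B \<in> F \<Longrightarrow> C \<inter> \<Union>F \<subseteq> B \<Longrightarrow>
    join_tree (insert C F) (insert (B, C) (insert (C, B) P))"

lemma join_tree_arcs_verts:
  "join_tree F P \<Longrightarrow> (X, Y) \<in> P \<Longrightarrow> X \<in> F \<and> Y \<in> F \<and> X \<noteq> Y"
  by (induction rule: join_tree.induct) auto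

lemma join_tree_finite: "join_tree F P \<Longrightarrow> finite F \<and> finite P \<and> F \<noteq> {}"
  by (induction rule: join_tree.induct) auto

lemma join_tree_sym: "join_tree F P \<Longrightarrow> sym P"
  by (induction rule: join_tree.induct) (auto simp: sym_def)

lemma join_tree_connected:
  "join_tree F P \<Longrightarrow> X \<in> F \<Longrightarrow> Y \<in> F \<Longrightarrow> (X, Y) \<in> P\<^sup>*"
proof (induction arbitrary: X Y rule: join_tree.induct)
  case (attach F P C B)
  let ?Q = "insert (B, C) (insert (C, B) P)"
  have mono: "P\<^sup>* \<subseteq> ?Q\<^sup>*" by (rule rtrancl_mono) auto
  have "(Z, B) \<in> ?Q\<^sup>* \<and> (B, Z) \<in> ?Q\<^sup>*" if "Z \<in> insert C F" for Z
    using that attach.IH[of Z B] attach.IH[of B Z] attach.hyps mono by auto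
  then show ?case using attach.prems by (meson rtrancl_trans)
qed auto

text \<open>Attaching depends only on intersections, so \<open>D\<close> can take over the place of
  \<open>C\<close> throughout the construction. This serves the return of a deleted simplicial
  vertex whose neighbourhood was itself a maximal clique.\<close>

lemma join_tree_replace:
  assumes "join_tree F P" "C \<in> F" "D \<notin> F" "\<forall>X\<in>F - {C}. D \<inter> X = C \<inter> X"
  shows "\<exists>P'. join_tree (insert D (F - {C})) P'"
  using assms
proof (induction arbitrary: rule: join_tree.induct)
  case (single A)
  then show ?case using join_tree.single[of D] by auto
next
  case (attach F P A B)
  show ?case
  proof (cases "C = A")
    case True
    have "D \<inter> X = A \<inter> X" if "X \<in> F" for X using attach.prems(3) attach.hyps(2) that True by blast
    then have "D \<inter> \<Union>F \<subseteq> B" using attach.hyps(4) by blast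
    with attach have "join_tree (insert D F) (insert (B, D) (insert (D, B) P))"
      by (intro join_tree.attach) auto
    with True attach.hyps show ?thesis by auto
  next
    case False
    with attach obtain P' where P': "join_tree (insert D (F - {C})) P'" by auto
    have CF: "C \<in> F" using False attach.prems by auto
    have AD: "A \<inter> D = A \<inter> C" using attach.prems(3) False by blast
    \<comment> \<open>A node that hung on \<open>C\<close> now hangs on \<open>D\<close>.\<close>
    define B' where "B' = (if B = C then D else B)"
    have "B' \<in> insert D (F - {C})" using attach.hyps by (auto simp: B'_def)
    moreover have "A \<notin> insert D (F - {C})" using attach by auto
    moreover have "A \<inter> \<Union>(insert D (F - {C})) \<subseteq> B'"
      using attach.hyps CF AD unfolding B'_def by (cases "B = C") auto
    ultimately have "join_tree (insert A (insert D (F - {C})))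
        (insert (B', A) (insert (A, B') P'))"
      using P' by (intro join_tree.attach)
    moreover have "insert A (insert D (F - {C})) = insert D (insert A F - {C})"
      using False by auto
    ultimately show ?thesis by metis
  qed
qed

text \<open>The newest node \<open>C\<close> has \<open>B\<close> as its only neighbour, so a path
  can meet it only at an end. Cutting it off leaves an older path ending in \<open>B\<close>, and
  \<open>B\<close> contains all that \<open>C\<close> shares with older nodes.\<close>

lemma join_tree_path:
  assumes "join_tree F P" "successively (\<lambda>X Y. (X, Y) \<in> P) xs" "distinct xs" "xs \<noteq> []"
    "Z \<in> set xs" "set xs \<subseteq> F"
  shows "hd xs \<inter> last xs \<subseteq> Z"
  using assms
proof (induction arbitrary: xs Z rule: join_tree.induct)
  case (single A)
  then show ?case by (cases xs) auto
next
  case (attach F P C B)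
  define R where "R X Y \<longleftrightarrow> (X, Y) \<in> insert (B, C) (insert (C, B) P)" for X Y
  note prems = attach.prems[folded R_def]
  have nb: "X = B" if "R X C \<or> R C X" for X
    using that attach.hyps(2) join_tree_arcs_verts[OF attach.hyps(1)] unfolding R_def by auto
  have R_old: "(X, Y) \<in> P" if "R X Y" "X \<noteq> C" "Y \<noteq> C" for X Y
    using that by (auto simp: R_def)
  have old: "hd us \<inter> last us \<subseteq> W"
    if "successively R us" "distinct us" "us \<noteq> []" "W \<in> set us"
      "set us \<subseteq> F" for us W
  proof (rule attach.IH)
    show "successively (\<lambda>X Y. (X, Y) \<in> P) us"
      using that(1) by (rule successively_mono) (use R_old that(5) attach.hyps(2) in blast)
  qed (use that in auto)
  show ?case
  proof (cases "C \<in> set xs")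
    case False
    then show ?thesis using old prems by blast
  next
    case True
    then obtain ys zs where xs: "xs = ys @ C # zs" by (meson split_list)
    have sub: "set ys \<subseteq> F" "set zs \<subseteq> F" using prems xs by auto
    have suc: "successively R ys" "successively R zs"
      and "ys \<noteq> [] \<Longrightarrow> R (last ys) C" "zs \<noteq> [] \<Longrightarrow> R C (hd zs)"
      using prems(1) unfolding xs by (auto simp: successively_append_iff successively_Cons)
    then have 1: "ys \<noteq> [] \<Longrightarrow> last ys = B" and 2: "zs \<noteq> [] \<Longrightarrow> hd zs = B"
      using nb by blast+
    \<comment> \<open>An interior \<open>C\<close> would have \<open>B\<close> on both sides,
      against distinctness.\<close>
    have "ys = [] \<or> zs = []"
    proof (rule ccontr)
      assume "\<not> ?thesis"
      then have "B \<in> set ys" "B \<in> set zs" using 1 2 last_in_set hd_in_set by metis+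
      then show False using prems(2) xs by auto
    qed
    moreover have ?thesis if "ys = []" "zs = []" using that xs prems by auto
    moreover have ?thesis if e: "ys = []" "zs \<noteq> []"
    proof -
      have "last zs \<in> F" using e sub last_in_set by blast
      then have "C \<inter> last zs \<subseteq> B \<inter> last zs" using attach.hyps by auto
      then show ?thesis using old[of zs Z] 2 e suc sub xs prems by auto
    qed
    moreover have ?thesis if e: "zs = []" "ys \<noteq> []"
    proof -
      have "hd ys \<in> F" using e sub hd_in_set by blast
      then have "hd ys \<inter> C \<subseteq> hd ys \<inter> B" using attach.hyps by auto
      then show ?thesis using old[of ys Z] 1 e suc sub xs prems by auto
    qed
    ultimately show ?thesis by blast
  qed
qed

text \<open>The list names each vertex of a cycle once and is closed by the arc from last to first;
  three entries rule out running back and forth along one edge. The newest node of a cycle would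
  need two different neighbours but has only \<open>B\<close>.\<close>

lemma join_tree_no_cycle:
  assumes "join_tree F P" "successively (\<lambda>X Y. (X, Y) \<in> P) xs" "distinct xs" "3 \<le> length xs"
    "(last xs, hd xs) \<in> P"
  shows False
  using assms
proof (induction arbitrary: xs rule: join_tree.induct)
  case (attach F P C B)
  define R where "R X Y \<longleftrightarrow> (X, Y) \<in> insert (B, C) (insert (C, B) P)" for X Y
  note prems = attach.prems[folded R_def]
  have nb: "X = B" if "R X C \<or> R C X" for X
    using that attach.hyps(2) join_tree_arcs_verts[OF attach.hyps(1)] unfolding R_def by auto
  have R_old: "(X, Y) \<in> P" if "R X Y" "X \<noteq> C" "Y \<noteq> C" for X Y
    using that by (auto simp: R_def)
  show ?case
  proof (cases "C \<in> set xs")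
    case False
    have "xs \<noteq> []" using prems by auto
    then have "last xs \<noteq> C" "hd xs \<noteq> C" using False last_in_set hd_in_set by metis+
    then have "(last xs, hd xs) \<in> P" using R_old prems(4) by blast
    moreover have "successively (\<lambda>X Y. (X, Y) \<in> P) xs"
      using prems(1) by (rule successively_mono) (use R_old False in blast)
    ultimately show False using attach.IH prems by blast
  next
    case True
    then obtain ys zs where xs: "xs = ys @ C # zs" by (meson split_list)
    have suc: "successively R ys" "successively R zs"
      and "ys \<noteq> [] \<Longrightarrow> R (last ys) C" "zs \<noteq> [] \<Longrightarrow> R C (hd zs)"
      using prems(1) unfolding xs by (auto simp: successively_append_iff successively_Cons)
    then have 1: "ys \<noteq> [] \<Longrightarrow> last ys = B" and 2: "zs \<noteq> [] \<Longrightarrow> hd zs = B"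
      using nb by blast+
    consider "ys \<noteq> []" "zs \<noteq> []" | "ys = []" "zs \<noteq> []" | "ys \<noteq> []" "zs = []"
      using prems(3) xs by fastforce
    then show False
    proof cases
      case 1
      then have "B \<in> set ys" "B \<in> set zs" using \<open>ys \<noteq> [] \<Longrightarrow> last ys = B\<close> 2 last_in_set hd_in_set by metis+
      then show False using prems(2) xs by auto
    next
      case 2
      \<comment> \<open>Here \<open>C\<close> opens the list, so its successor and, across the
        closing arc, the last entry are both \<open>B\<close>.\<close>
      then have "last zs = B" "hd zs = B"
        using prems(4) nb[of "last zs"] \<open>zs \<noteq> [] \<Longrightarrow> hd zs = B\<close> xs by auto
      moreover obtain a b us where "zs = a # b # us"
        using prems(3) xs 2 by (cases zs; cases "tl zs") auto
      ultimately show False using prems(2) xs last_in_set[of "b # us"] by auto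
    next
      case 3
      then have "last ys = B" "hd ys = B" using prems(4) nb[of "hd ys"] 1 3 xs by auto
      moreover obtain a b us where "ys = a # b # us"
        using prems(3) xs 3 by (cases ys; cases "tl ys") auto
      ultimately show False using prems(2) xs last_in_set[of "b # us"] by auto
    qed
  qed
qed auto

section \<open>Graphs without holes\<close>

text \<open>Steps stay inside \<open>A\<close>, but the empty walk from x to x exists for every x,
  also outside \<open>A\<close>.\<close>

definition reach_in :: "('a \<Rightarrow> 'a \<Rightarrow> bool) \<Rightarrow> 'a set \<Rightarrow> 'a \<Rightarrow> 'a \<Rightarrow> bool" where
  "reach_in E A = (\<lambda>x y. E x y \<and> x \<in> A \<and> y \<in> A)\<^sup>*\<^sup>*"

text \<open>These are the maximal cliques of the subgraph induced on \<open>V\<close>. With a bare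
  relation, passing to a subgraph only shrinks \<open>V\<close>.\<close>

definition maxcl :: "('a \<Rightarrow> 'a \<Rightarrow> bool) \<Rightarrow> 'a set \<Rightarrow> 'a set set" where
  "maxcl E V = {K. K \<subseteq> V \<and> pairwise E K \<and> (\<forall>K'. K' \<subseteq> V \<and> pairwise E K' \<and> K \<subseteq> K' \<longrightarrow> K' = K)}"

text \<open>
  A is meant to avoid the closed neighbourhood of v, so that a shortest path from x to y through A
  would close up with v to a chordless cycle.
\<close>
definition hole_free :: "('a \<Rightarrow> 'a \<Rightarrow> bool) \<Rightarrow> 'a set \<Rightarrow> bool" where
  "hole_free E V \<longleftrightarrow> (\<forall>v x y A. v \<in> V \<and> x \<in> V \<and> y \<in> V \<and> A \<subseteq> V \<and> E v x \<and> E v y \<and> x \<noteq> y \<and> \<not> E x y \<and>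
     (\<forall>a\<in>A. a \<noteq> v \<and> \<not> E v a) \<longrightarrow> \<not> reach_in E (insert x (insert y A)) x y)"

lemma hole_free_subset:
  assumes "hole_free E V" "W \<subseteq> V"
  shows "hole_free E W"
  unfolding hole_free_def
proof (intro allI impI, elim conjE)
  fix v x y A
  assume "v \<in> W" "x \<in> W" "y \<in> W" "A \<subseteq> W" "E v x" "E v y" "x \<noteq> y" "\<not> E x y"
    and "\<forall>a\<in>A. a \<noteq> v \<and> \<not> E v a"
  moreover have "A \<subseteq> V" using \<open>A \<subseteq> W\<close> assms(2) by simp
  ultimately show "\<not> reach_in E (insert x (insert y A)) x y"
    using assms(1)[unfolded hole_free_def, rule_format, of v x y A] assms(2) by blast
qed

lemma reach_in_refl [simp]: "reach_in E A x x"
  by (simp add: reach_in_def)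

lemma reach_in_step: "reach_in E A x y \<Longrightarrow> E y z \<Longrightarrow> y \<in> A \<Longrightarrow> z \<in> A \<Longrightarrow> reach_in E A x z"
  unfolding reach_in_def by (rule rtranclp.rtrancl_into_rtrancl) auto

lemma reach_in_edge: "E y z \<Longrightarrow> y \<in> A \<Longrightarrow> z \<in> A \<Longrightarrow> reach_in E A y z"
  by (rule reach_in_step[OF reach_in_refl])

lemma reach_in_trans: "reach_in E A x y \<Longrightarrow> reach_in E A y z \<Longrightarrow> reach_in E A x z"
  unfolding reach_in_def by (rule rtranclp_trans)

lemma reach_in_mono: "reach_in E A x y \<Longrightarrow> A \<subseteq> B \<Longrightarrow> reach_in E B x y"
  unfolding reach_in_def by (erule rtranclp_mono[THEN predicate2D, rotated]) auto

lemma reach_in_induct [consumes 1, case_names refl step]: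
  assumes "reach_in E A x y" "Q x"
    "\<And>y z. reach_in E A x y \<Longrightarrow> Q y \<Longrightarrow> E y z \<Longrightarrow> y \<in> A \<Longrightarrow> z \<in> A \<Longrightarrow> Q z"
  shows "Q y"
  using assms(1) unfolding reach_in_def
proof (induction rule: rtranclp_induct)
  case base
  show ?case by (rule assms(2))
next
  case (step y z)
  then show ?case using assms(3)[of y z] by (simp add: reach_in_def)
qed

lemma reach_in_mem: "reach_in E A x y \<Longrightarrow> x \<in> A \<Longrightarrow> y \<in> A"
  by (induction rule: reach_in_induct) auto

text \<open>Each vertex on a walk from x is itself reachable from x; hence a component is connected
  within itself.\<close>

lemma reach_in_closed:
  assumes "reach_in E A x y"
  shows "reach_in E {z. reach_in E A x z} x y"
  using assms
proof (induction rule: reach_in_induct)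
  case (step y z)
  then show ?case using reach_in_step[of E A x y z]
    by (intro reach_in_step[of E _ x y z]) auto
qed simp

lemma maxcl_clique: "C \<in> maxcl E V \<Longrightarrow> pairwise E C" "C \<in> maxcl E V \<Longrightarrow> C \<subseteq> V"
  by (auto simp: maxcl_def)

lemma maxcl_maximal: "C \<in> maxcl E V \<Longrightarrow> K \<subseteq> V \<Longrightarrow> pairwise E K \<Longrightarrow> C \<subseteq> K \<Longrightarrow> K = C"
  by (auto simp: maxcl_def)

lemma maxclI:
  assumes "C \<subseteq> V" "pairwise E C" "\<And>K. K \<subseteq> V \<Longrightarrow> pairwise E K \<Longrightarrow> C \<subseteq> K \<Longrightarrow> K \<subseteq> C"
  shows "C \<in> maxcl E V"
  using assms unfolding maxcl_def by blast

lemma clique_in_maxcl: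
  assumes "finite V" "K \<subseteq> V" "pairwise E K"
  obtains D where "D \<in> maxcl E V" "K \<subseteq> D"
proof -
  let ?X = "{D. D \<subseteq> V \<and> pairwise E D}"
  have "finite ?X" using assms(1) by simp
  moreover have "K \<in> ?X" using assms by simp
  ultimately obtain D where "D \<in> ?X" "K \<subseteq> D" "\<forall>B\<in>?X. D \<subseteq> B \<longrightarrow> D = B"
    using finite_has_maximal2[of ?X K] by blast
  then show thesis by (intro that[of D]) (auto intro!: maxclI)
qed

section \<open>Simplicial vertices, their deletion, and the resulting join tree\<close>

locale adjacency =
  fixes E :: "'a \<Rightarrow> 'a \<Rightarrow> bool"
  assumes sym: "E x y \<Longrightarrow> E y x" and irrefl: "\<not> E x x"
begin

lemma reach_in_sym: "reach_in E A x y \<Longrightarrow> reach_in E A y x"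
proof (induction rule: reach_in_induct)
  case (step y z)
  then have "reach_in E A z y" using sym[of y z] by (intro reach_in_edge) auto
  then show ?case using step.IH by (rule reach_in_trans)
qed simp

text \<open>
  Let \<Gamma> be a component of the set of non-neighbours of v. Its neighbourhood S is a clique, as
  there are no holes, and induction applies to the graph on \<Gamma> \<union> S, which does not contain v.
\<close>
lemma simplicial_nonneighbour:
  assumes "finite V" "hole_free E V" "v \<in> V" "u \<in> V" "u \<noteq> v" "\<not> E v u"
  obtains w where "w \<in> V" "w \<noteq> v" "\<not> E v w" "pairwise E {z \<in> V. E w z}"
proof -
  have "\<exists>w\<in>V. w \<noteq> v \<and> \<not> E v w \<and> pairwise E {z \<in> V. E w z}"
    using assms
  proof (induction "card V" arbitrary: V v u rule: less_induct)
    case less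
    define W where "W = {z \<in> V. z \<noteq> v \<and> \<not> E v z}"
    define \<Gamma> where "\<Gamma> = {z. reach_in E W u z}"
    define S where "S = {s \<in> V - \<Gamma>. \<exists>g\<in>\<Gamma>. E g s}"
    have uG: "u \<in> \<Gamma>" by (simp add: \<Gamma>_def)
    have uW: "u \<in> W" using less by (auto simp: W_def)
    have GW: "\<Gamma> \<subseteq> W" unfolding \<Gamma>_def using reach_in_mem uW by fast
    \<comment> \<open>A boundary vertex of \<Gamma> not adjacent to v would lie in \<open>W\<close>,
      and the component would have absorbed it.\<close>
    have Sv: "E v s" if sS: "s \<in> S" for s
    proof (rule ccontr)
      assume "\<not> E v s"
      obtain g where g: "g \<in> \<Gamma>" "E g s" using sS by (auto simp: S_def)
      have "s \<noteq> v" using g GW by (auto simp: W_def dest: sym)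
      then have "s \<in> W" using that \<open>\<not> E v s\<close> by (auto simp: W_def S_def)
      then have "s \<in> \<Gamma>" using g GW reach_in_step[of E W u g s] by (auto simp: \<Gamma>_def)
      then show False using that by (simp add: S_def)
    qed
    have Gcon: "reach_in E \<Gamma> g h" if "g \<in> \<Gamma>" "h \<in> \<Gamma>" for g h
      using that reach_in_closed[of E W u g] reach_in_closed[of E W u h] unfolding \<Gamma>_def
      by (blast intro: reach_in_trans reach_in_sym)
    \<comment> \<open>Two non-adjacent members of \<open>S\<close> would be joined through \<Gamma>,
      which avoids the closed neighbourhood of v.\<close>
    have Sclique: "E x y" if xy: "x \<in> S" "y \<in> S" "x \<noteq> y" for x y
    proof (rule ccontr)
      assume nE: "\<not> E x y"
      obtain g h where gh: "g \<in> \<Gamma>" "E g x" "h \<in> \<Gamma>" "E h y" using xy by (auto simp: S_def)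
      have "reach_in E (insert x (insert y \<Gamma>)) g h"
        using Gcon[of g h] gh by (blast intro: reach_in_mono)
      then have "reach_in E (insert x (insert y \<Gamma>)) x y"
        using gh by (blast intro: reach_in_trans reach_in_edge sym)
      moreover have "\<not> reach_in E (insert x (insert y \<Gamma>)) x y"
        using less.prems(2)[unfolded hole_free_def, rule_format, of v x y \<Gamma>]
          less.prems xy Sv nE GW by (auto simp: S_def W_def)
      ultimately show False by blast
    qed
    let ?V = "\<Gamma> \<union> S"
    have sub: "?V \<subseteq> V" using GW by (auto simp: W_def S_def)
    have "v \<notin> ?V" using GW Sv irrefl by (auto simp: W_def)
    then have card: "card ?V < card V" using sub less.prems by (intro psubset_card_mono) auto
    \<comment> \<open>A vertex of \<Gamma> has all its neighbours in
      \<open>\<Gamma> \<union> S\<close>, so being simplicial there is the same as in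
      \<open>V\<close>.\<close>
    have simp\<Gamma>: "\<exists>w\<in>V. w \<noteq> v \<and> \<not> E v w \<and> pairwise E {z \<in> V. E w z}"
      if "w \<in> \<Gamma>" "pairwise E {z \<in> ?V. E w z}" for w
    proof -
      have "{z \<in> V. E w z} = {z \<in> ?V. E w z}" using that sub by (auto simp: S_def)
      then show ?thesis using that GW by (intro bexI[of _ w]) (auto simp: W_def)
    qed
    have IH: "\<exists>w\<in>?V. w \<noteq> p \<and> \<not> E p w \<and> pairwise E {z \<in> ?V. E w z}"
      if "p \<in> ?V" "q \<in> ?V" "q \<noteq> p" "\<not> E p q" for p q
      using less.hyps[OF card, of p q] that less.prems sub hole_free_subset finite_subset by blast
    \<comment> \<open>A reference vertex p that is equal or adjacent to every member of
      \<open>S\<close> forces the simplicial vertex of the induction hypothesis into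
      \<Gamma>.\<close>
    have far: ?case
      if pq: "p \<in> ?V" "q \<in> ?V" "q \<noteq> p" "\<not> E p q" and S: "\<forall>w\<in>S. w = p \<or> E p w" for p q
    proof -
      obtain w where w: "w \<in> ?V" "w \<noteq> p" "\<not> E p w" "pairwise E {z \<in> ?V. E w z}"
        using IH[OF pq] by blast
      have "w \<in> \<Gamma>" using S w(1-3) by blast
      then show ?thesis using simp\<Gamma> w(4) by blast
    qed
    show ?case
    proof (cases "pairwise E ?V")
      case True
      then show ?thesis using simp\<Gamma>[OF uG] by (auto simp: pairwise_def)
    next
      case False
      then obtain p q where pq: "p \<in> ?V" "q \<in> ?V" "q \<noteq> p" "\<not> E p q" by (auto simp: pairwise_def)
      show ?thesis
      \<comment> \<open>If some s in \<open>S\<close> has a non-neighbour, s is the reference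
        vertex, since \<open>S\<close> is a clique. Otherwise \<open>S\<close> is adjacent to
        everything, and any non-adjacent pair works.\<close>
      proof (cases "\<exists>s\<in>S. \<exists>t\<in>?V. t \<noteq> s \<and> \<not> E s t")
        case True
        then obtain s t where st: "s \<in> S" "t \<in> ?V" "t \<noteq> s" "\<not> E s t" by blast
        have "s \<in> ?V" using st(1) by blast
        moreover have "\<forall>w\<in>S. w = s \<or> E s w" using Sclique[OF st(1)] by metis
        ultimately show ?thesis using far[OF _ st(2-4)] by metis
      next
        case False
        have "\<forall>w\<in>S. w = p \<or> E p w" using False pq(1) sym by metis
        then show ?thesis using far[OF pq] by metis
      qed
    qed
  qed
  then show thesis using that by blast
qed

lemma simplicial_exists:
  assumes "finite V" "hole_free E V" "V \<noteq> {}"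
  obtains w where "w \<in> V" "pairwise E {z \<in> V. E w z}"
proof (cases "pairwise E V")
  case True
  then show thesis using that assms(3) by (auto simp: pairwise_def)
next
  case False
  then obtain p q where "p \<in> V" "q \<in> V" "p \<noteq> q" "\<not> E p q" by (auto simp: pairwise_def)
  then obtain w where "w \<in> V" "pairwise E {z \<in> V. E w z}"
    using simplicial_nonneighbour[OF assms(1,2), of p q] by blast
  then show thesis by (rule that)
qed

text \<open>The only maximal clique through w is its closed neighbourhood. A maximal clique of the
  remainder loses maximality only if w extends it, and then it is the whole neighbourhood of
  w.\<close>

lemma maxcl_delete_simplicial:
  assumes "finite V" "w \<in> V" "pairwise E {z \<in> V. E w z}"
  shows "maxcl E V = insert (insert w {z \<in> V. E w z}) (maxcl E (V - {w}) - {{z \<in> V. E w z}})"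
    (is "_ = insert ?K (_ - {?N})")
proof -
  have Kcl: "pairwise E ?K" using assms(3) sym[of w] by (simp add: pairwise_insert)
  have wN: "w \<notin> ?N" using irrefl by auto
  have inK: "D \<subseteq> ?K" if "D \<subseteq> V" "pairwise E D" "w \<in> D" for D
    using that by (auto simp: pairwise_def)
  have K: "?K \<in> maxcl E V" using assms Kcl inK by (intro maxclI) auto
  show ?thesis
  proof (intro equalityI subsetI)
    fix D assume D: "D \<in> maxcl E V"
    show "D \<in> insert ?K (maxcl E (V - {w}) - {?N})"
    proof (cases "w \<in> D")
      case True
      then have "D = ?K"
        using inK[of D] maxcl_clique[OF D] maxcl_maximal[OF D, of ?K] Kcl assms(2) by auto
      then show ?thesis by simp
    next
      case False
      have "D \<in> maxcl E (V - {w})"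
        using False maxcl_clique[OF D] maxcl_maximal[OF D] by (intro maxclI) auto
      moreover have "D \<noteq> ?N"
        using maxcl_maximal[OF D, of ?K] Kcl assms(2) False by auto
      ultimately show ?thesis by simp
    qed
  next
    fix D assume "D \<in> insert ?K (maxcl E (V - {w}) - {?N})"
    moreover have "D \<in> maxcl E V" if D: "D \<in> maxcl E (V - {w})" and ne: "D \<noteq> ?N"
    proof (rule maxclI)
      show "D \<subseteq> V" "pairwise E D" using maxcl_clique[OF D] by auto
      fix L assume L: "L \<subseteq> V" "pairwise E L" "D \<subseteq> L"
      have wD: "w \<notin> D" using maxcl_clique[OF D] by auto
      have "L - {w} = D" using L wD by (intro maxcl_maximal[OF D]) (auto simp: pairwise_def)
      moreover have False if "w \<in> L"
      proof -
        have "D \<subseteq> ?N" using inK[OF L(1,2) that] L(3) wD by auto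
        then have "?N = D" using assms(3) wN by (intro maxcl_maximal[OF D]) auto
        then show False using ne by simp
      qed
      ultimately show "L \<subseteq> D" by auto
    qed
    ultimately show "D \<in> maxcl E V" using K by auto
  qed
qed

lemma join_tree_maxcl:
  assumes "finite V" "hole_free E V" "V \<noteq> {}"
  shows "\<exists>P. join_tree (maxcl E V) P"
  using assms
proof (induction "card V" arbitrary: V rule: less_induct)
  case less
  obtain w where w: "w \<in> V" "pairwise E {z \<in> V. E w z}"
    using simplicial_exists[OF less.prems] .
  let ?N = "{z \<in> V. E w z}"
  let ?K = "insert w ?N"
  have wN: "w \<notin> ?N" using irrefl by auto
  note eq = maxcl_delete_simplicial[OF less.prems(1) w]
  show ?case
  proof (cases "V = {w}")
    case True
    have "maxcl E V = {{w}}" using True by (auto simp: maxcl_def pairwise_def)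
    then show ?thesis using join_tree.single by metis
  next
    case False
    obtain P where P: "join_tree (maxcl E (V - {w})) P"
      using less.hyps[of "V - {w}"] less.prems w False
      by (metis Diff_eq_empty_iff Diff_subset card_Diff1_less finite_Diff hole_free_subset
          subset_singletonD)
    have notw: "w \<notin> X" if "X \<in> maxcl E (V - {w})" for X using maxcl_clique[OF that] by auto
    then have Knew: "?K \<notin> maxcl E (V - {w})" by blast
    show ?thesis
    \<comment> \<open>Either the node \<open>?N\<close> grows to \<open>?K\<close> in place, or
      \<open>?K\<close> is new and becomes a leaf at a clique containing \<open>?N\<close>.\<close>
    proof (cases "?N \<in> maxcl E (V - {w})")
      case True
      have "\<forall>X\<in>maxcl E (V - {w}) - {?N}. ?K \<inter> X = ?N \<inter> X" using notw by blast
      from join_tree_replace[OF P True Knew this] show ?thesis using eq by simp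
    next
      case False
      have "?N \<subseteq> V - {w}" using wN by auto
      then obtain B where B: "B \<in> maxcl E (V - {w})" "?N \<subseteq> B"
        using clique_in_maxcl[of "V - {w}" ?N E] less.prems(1) w(2) by (metis finite_Diff)
      have "?K \<inter> \<Union>(maxcl E (V - {w})) \<subseteq> B" using B notw by blast
      from join_tree.attach[OF P Knew B(1) this] show ?thesis using eq False by auto
    qed
  qed
qed

text \<open>No new maximal clique appears: a clique of the spanned subgraph that lies in
  \<open>C\<close> consists of vertices shared with other cliques, hence lies in \<open>B\<close>.
  Existence of join trees thus applies to the remaining cliques.\<close>

lemma maxcl_delete_leaf:
  assumes "finite V" "C \<in> maxcl E V" "B \<in> maxcl E V - {C}" "C \<inter> \<Union>(maxcl E V - {C}) \<subseteq> B"
  shows "maxcl E (\<Union>(maxcl E V - {C})) = maxcl E V - {C}"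
proof (intro equalityI subsetI)
  let ?U = "\<Union>(maxcl E V - {C})"
  have U: "?U \<subseteq> V" using maxcl_clique by blast
  {
    fix K assume K: "K \<in> maxcl E ?U"
    obtain D where D: "D \<in> maxcl E V" "K \<subseteq> D"
      using clique_in_maxcl[OF assms(1), of K E] maxcl_clique[OF K] U by blast
    obtain D' where D': "D' \<in> maxcl E V - {C}" "K \<subseteq> D'"
    proof (cases "D = C")
      case True
      then have "K \<subseteq> B" using D maxcl_clique[OF K] assms(4) by blast
      then show ?thesis using that assms(3) by blast
    qed (use that D in auto)
    then have "D' = K" using maxcl_maximal[OF K, of D'] maxcl_clique[of D' E V] by blast
    then show "K \<in> maxcl E V - {C}" using D' by simp
  }
  fix K assume K: "K \<in> maxcl E V - {C}"
  show "K \<in> maxcl E ?U"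
  proof (rule maxclI)
    show "K \<subseteq> ?U" using K by blast
    show "pairwise E K" using K maxcl_clique by blast
    show "L \<subseteq> K" if "L \<subseteq> ?U" "pairwise E L" "K \<subseteq> L" for L
      using maxcl_maximal[of K E V L] K that U by blast
  qed
qed

text \<open>A walk enters and leaves w through neighbours that are equal or adjacent, so the visit
  to w can be cut short.\<close>

lemma reach_in_avoid_simplicial:
  assumes "reach_in E A x y" "x \<noteq> w" "y \<noteq> w" and simp: "pairwise E {z \<in> A. E w z}"
  shows "reach_in E (A - {w}) x y"
proof -
  \<comment> \<open>The invariant for a walk now at w: every neighbour of w in \<open>A\<close> is
    already reached without w.\<close>
  have "(y \<noteq> w \<longrightarrow> reach_in E (A - {w}) x y) \<and>
      (y = w \<longrightarrow> (\<forall>z\<in>A. E w z \<longrightarrow> reach_in E (A - {w}) x z))"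
    using assms(1)
  proof (induction rule: reach_in_induct)
    case refl
    then show ?case using assms(2) by simp
  next
    case (step y z)
    have nbr: "reach_in E (A - {w}) x t" if t: "z = w" "t \<in> A" "E w t" for t
    proof -
      have y: "y \<noteq> w" "E w y" using step t irrefl sym[of y w] by auto
      have "t = y \<or> E y t" using simp y t step by (auto simp: pairwise_def)
      moreover have "t \<noteq> w" using t irrefl by auto
      ultimately show ?thesis using step y t reach_in_step[of E "A - {w}" x y t] by auto
    qed
    show ?case
    proof (cases "z = w")
      case True
      then show ?thesis using nbr by blast
    next
      case False
      then show ?thesis using step reach_in_step[of E "A - {w}" x y z] by (cases "y = w") auto
    qed
  qed
  then show ?thesis using assms(3) by simp
qed

text \<open>
  The vertex c has neighbourhood S, so simplicial vertices far from c lie in \<Gamma>; they are deleted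
  until a single vertex is left.
\<close>
lemma full_vertex:
  assumes "finite \<Gamma>" "finite S" "\<Gamma> \<noteq> {}" "hole_free E (insert c (S \<union> \<Gamma>))"
    and "\<And>z. z \<in> S \<Longrightarrow> E c z" "\<And>z. z \<in> \<Gamma> \<Longrightarrow> z \<noteq> c \<and> \<not> E c z"
    and "\<And>x s. x \<in> \<Gamma> \<Longrightarrow> s \<in> S \<Longrightarrow> reach_in E (insert s \<Gamma>) x s"
  obtains w where "w \<in> \<Gamma>" "\<And>s. s \<in> S \<Longrightarrow> E w s"
proof -
  have "\<exists>w\<in>\<Gamma>. \<forall>s\<in>S. E w s"
    using assms
  proof (induction "card \<Gamma>" arbitrary: \<Gamma> rule: less_induct)
    case less
    let ?V = "insert c (S \<union> \<Gamma>)"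
    have S\<Gamma>: "S \<inter> \<Gamma> = {}" using less.prems(5,6) by blast
    obtain u where u: "u \<in> \<Gamma>" using less.prems(3) by blast
    obtain w where w: "w \<in> ?V" "w \<noteq> c" "\<not> E c w" "pairwise E {z \<in> ?V. E w z}"
      using simplicial_nonneighbour[of ?V c u] less.prems u by auto
    then have w\<Gamma>: "w \<in> \<Gamma>" using less.prems(5) by auto
    show ?case
    proof (cases "\<Gamma> = {w}")
      case True
      have "E w s" if s: "s \<in> S" for s
      proof -
        have "reach_in E {s, w} w s" using less.prems(7)[OF w\<Gamma> s] True by simp
        \<comment> \<open>Inside \<open>{s, w}\<close> the walk from w can leave w only by the edge
          to s.\<close>
        moreover have "z = w \<or> (z = s \<and> E w s)" if "reach_in E {s, w} w z" for z
          using that by (induction rule: reach_in_induct) auto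
        ultimately show ?thesis using s S\<Gamma> w\<Gamma> by blast
      qed
      then show ?thesis using w\<Gamma> by blast
    next
      case False
      have "\<exists>w'\<in>\<Gamma> - {w}. \<forall>s\<in>S. E w' s"
      proof (rule less.hyps)
        show "card (\<Gamma> - {w}) < card \<Gamma>" using w\<Gamma> less.prems(1) by (rule card_Diff1_less[rotated])
        show "hole_free E (insert c (S \<union> (\<Gamma> - {w})))"
          using less.prems(4) by (rule hole_free_subset) auto
        show "reach_in E (insert s (\<Gamma> - {w})) x s" if "x \<in> \<Gamma> - {w}" "s \<in> S" for x s
        proof -
          have "reach_in E (insert s \<Gamma> - {w}) x s"
            using that less.prems(7)[of x s] S\<Gamma> w\<Gamma> w(4)
            by (intro reach_in_avoid_simplicial) (auto simp: pairwise_def)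
          moreover have "insert s \<Gamma> - {w} = insert s (\<Gamma> - {w})" using that S\<Gamma> w\<Gamma> by auto
          ultimately show ?thesis by simp
        qed
      qed (use less.prems False w\<Gamma> in auto)
      then show ?thesis by blast
    qed
  qed
  then show thesis using that by blast
qed

end

section \<open>Chordal graphs and clique trees\<close>

lemma reach_in_path:
  assumes "reach_in E A x y" "x \<in> A"
  shows "\<exists>xs. xs \<noteq> [] \<and> hd xs = x \<and> last xs = y \<and> successively E xs \<and> set xs \<subseteq> A"
  using assms(1)
proof (induction rule: reach_in_induct)
  case refl
  then show ?case using assms(2) by (intro exI[of _ "[x]"]) simp
next
  case (step y z)
  then obtain xs where "xs \<noteq> []" "hd xs = x" "last xs = y" "successively E xs" "set xs \<subseteq> A" by blast
  then show ?case using step.hyps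
    by (intro exI[of _ "xs @ [z]"]) (simp add: successively_append_iff)
qed

text \<open>A shortest path is taken: a repeated vertex or an edge skipping some vertices would
  shorten it.\<close>

lemma reach_in_induced_path:
  assumes "reach_in E A x y" "x \<in> A"
  obtains xs where "xs \<noteq> []" "hd xs = x" "last xs = y" "successively E xs" "set xs \<subseteq> A" "distinct xs"
    "\<And>as a bs b cs. xs = as @ a # bs @ b # cs \<Longrightarrow> E a b \<Longrightarrow> bs = []"
proof -
  define path where "path xs \<longleftrightarrow> xs \<noteq> [] \<and> hd xs = x \<and> last xs = y \<and> successively E xs \<and> set xs \<subseteq> A"
    for xs
  obtain xs where xs: "path xs" "\<And>ys. path ys \<Longrightarrow> length xs \<le> length ys"
    using reach_in_path[OF assms] ex_has_least_nat[of path _ length]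
    unfolding path_def[symmetric] by blast
  have "distinct xs"
  proof (rule ccontr)
    assume "\<not> distinct xs"
    then obtain as bs cs a where s: "xs = as @ [a] @ bs @ [a] @ cs" using not_distinct_decomp by blast
    then have "path (as @ a # cs)"
      using xs(1) by (auto simp: path_def successively_append_iff successively_Cons hd_append)
    then show False using xs(2) s by fastforce
  qed
  moreover have "bs = []" if s: "xs = as @ a # bs @ b # cs" and "E a b" for as a bs b cs
  proof -
    have "path (as @ a # b # cs)" using that xs(1)
      by (auto simp: path_def successively_append_iff successively_Cons hd_append)
    then show ?thesis using xs(2) s by fastforce
  qed
  ultimately show thesis using that xs(1) unfolding path_def by blast
qed

text \<open>The definition of \<open>chordal\<close> speaks of arcs of the cycle, the argument below
  of consecutive vertices; this connects the two.\<close>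

lemma (in pre_digraph) ends_of_walk:
  "cas u p v \<Longrightarrow> map (arc_to_ends G) p = zip (awalk_verts u p) (tl (awalk_verts u p))"
proof (induction p arbitrary: u)
  case (Cons e p)
  then have "awalk_verts (head G e) p = head G e # tl (awalk_verts (head G e) p)"
    by (cases p) auto
  then show ?case using Cons by (simp add: arc_to_ends_def) (metis zip_Cons_Cons)
qed simp

lemma (in wf_digraph) awalk_of_verts:
  assumes "successively (\<lambda>x y. x \<rightarrow>\<^bsub>G\<^esub> y) (u # vs)" "u \<in> verts G"
  shows "\<exists>p. awalk u p (last (u # vs)) \<and> awalk_verts u p = u # vs"
  using assms
proof (induction vs arbitrary: u)
  case Nil
  then show ?case by (intro exI[of _ "[]"]) (simp add: awalk_Nil_iff)
next
  case (Cons w vs)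
  then obtain e where e: "e \<in> arcs G" "tail G e = u" "head G e = w"
    by (auto simp: arcs_ends_def arc_to_ends_def)
  then obtain p where "awalk w p (last (w # vs))" "awalk_verts w p = w # vs"
    using Cons head_in_verts by fastforce
  then show ?case using e by (intro exI[of _ "e # p"]) (simp add: awalk_Cons_iff)
qed

lemma consecutive_in_zip_tl: "(a, b) \<in> set (zip (as @ a # b # cs) (tl (as @ a # b # cs)))"
proof (induction as)
  case (Cons c as)
  then show ?case by (cases as) auto
qed simp

lemma (in graph) adjacency: "adjacency (\<lambda>x y. x \<rightarrow>\<^bsub>G\<^esub> y)"
proof
  show "x \<rightarrow>\<^bsub>G\<^esub> y \<Longrightarrow> y \<rightarrow>\<^bsub>G\<^esub> x" for x y by (rule graph_symmetric)
  show "\<not> x \<rightarrow>\<^bsub>G\<^esub> x" for x using no_loops by (auto simp: arcs_ends_def arc_to_ends_def)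
qed

text \<open>A chord of the cycle formed by v and a chordless path from x to y would either join two
  path vertices or start at v, whose only neighbours on the path are x and y. In both cases it is an
  edge of the cycle.\<close>

lemma (in graph) hole_free_of_chordal:
  assumes "chordal G"
  shows "hole_free (\<lambda>x y. x \<rightarrow>\<^bsub>G\<^esub> y) (verts G)"
  unfolding hole_free_def
proof (intro allI impI notI, elim conjE)
  interpret adjacency "\<lambda>x y. x \<rightarrow>\<^bsub>G\<^esub> y" by (rule adjacency)
  fix v x y A
  assume v: "v \<in> verts G" "v \<rightarrow>\<^bsub>G\<^esub> x" "v \<rightarrow>\<^bsub>G\<^esub> y" and xy: "x \<noteq> y" "\<not> x \<rightarrow>\<^bsub>G\<^esub> y"
    and A: "\<forall>a\<in>A. a \<noteq> v \<and> \<not> v \<rightarrow>\<^bsub>G\<^esub> a"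
    and r: "reach_in (\<lambda>x y. x \<rightarrow>\<^bsub>G\<^esub> y) (insert x (insert y A)) x y"
  obtain xs where xs: "xs \<noteq> []" "hd xs = x" "last xs = y" "successively (\<lambda>x y. x \<rightarrow>\<^bsub>G\<^esub> y) xs"
    "set xs \<subseteq> insert x (insert y A)" "distinct xs"
    and ind: "\<And>as a bs b cs. xs = as @ a # bs @ b # cs \<Longrightarrow> a \<rightarrow>\<^bsub>G\<^esub> b \<Longrightarrow> bs = []"
    using reach_in_induced_path[OF r] by auto
  have vxs: "v \<notin> set xs" using xs(5) A v(2,3) irrefl by auto
  have "y \<rightarrow>\<^bsub>G\<^esub> v" using v(3) by (rule sym)
  then have "successively (\<lambda>x y. x \<rightarrow>\<^bsub>G\<^esub> y) (v # xs @ [v])"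
    using xs(1-4) v(2) by (simp add: successively_append_iff successively_Cons)
  then obtain p where p: "awalk v p v" "awalk_verts v p = v # xs @ [v]"
    using awalk_of_verts[of v "xs @ [v]"] v(1) by auto
  have len: "Suc (length p) = length xs + 2" using length_awalk_verts[of v p] p(2) by simp
  obtain us where us: "xs = x # us" using xs(1,2) by (cases xs) auto
  \<comment> \<open>As x and y are distinct and non-adjacent, the path has an inner vertex; with v
    the cycle has at least four vertices.\<close>
  have "3 \<le> length xs"
    using us xs(3,4) xy by (cases us; cases "tl us") (auto simp: successively_Cons)
  then have "4 \<le> length p" using len by simp
  moreover have "cycle p" unfolding cycle_def using p xs(6) vxs len by (intro exI[of _ v]) auto
  ultimately obtain s t where st: "s \<in> tail G ` set p" "t \<in> tail G ` set p" "s \<rightarrow>\<^bsub>G\<^esub> t"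
    and out: "(s, t) \<notin> arc_to_ends G ` set p" "(t, s) \<notin> arc_to_ends G ` set p"
    using assms unfolding chordal_def by blast
  have ends: "arc_to_ends G ` set p = set (zip (v # xs @ [v]) (tl (v # xs @ [v])))"
    using ends_of_walk[of v p v] p by (metis awalk_def list.set_map)
  have cons: "(a, b) \<in> arc_to_ends G ` set p" if "v # xs @ [v] = as @ a # b # cs" for as a b cs
    unfolding ends that by (rule consecutive_in_zip_tl)
  have vx: "(v, x) \<in> arc_to_ends G ` set p" using cons[of "[]" v x "us @ [v]"] us by simp
  have "xs = butlast xs @ [y]" using xs(1,3) by (metis append_butlast_last_id)
  then have yv: "(y, v) \<in> arc_to_ends G ` set p"
    using cons[of "v # butlast xs" y v "[]"] by (metis append.assoc append_Cons append_Nil)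
  have verts: "s \<in> insert v (set xs)" "t \<in> insert v (set xs)"
    using st(1,2) p awalk_verts_arc1[of _ p v] by auto
  have v_end: "z = x \<or> z = y" if "z \<in> set xs" "v \<rightarrow>\<^bsub>G\<^esub> z" for z using that xs(5) A by auto
  have inner: "(a, b) \<in> arc_to_ends G ` set p" if "xs = as @ a # bs @ b # cs" "a \<rightarrow>\<^bsub>G\<^esub> b" for as a bs b cs
    using cons[of "v # as" a b "cs @ [v]"] ind[OF that] that(1) by simp
  consider "s = v" "t \<in> set xs" | "t = v" "s \<in> set xs" | "s \<in> set xs" "t \<in> set xs"
    using verts st(3) irrefl by blast
  then show False
  proof cases
    case 1
    then show False using v_end[of t] st(3) vx yv out by auto
  next
    case 2
    then show False using v_end[of s] sym[OF st(3)] vx yv out by auto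
  next
    case 3
    obtain as bs where s: "xs = as @ s # bs" using 3 split_list by metis
    have "t \<noteq> s" using st(3) irrefl by auto
    then consider "t \<in> set as" | "t \<in> set bs" using 3 s by auto
    then show False
    proof cases
      case 1
      then obtain cs ds where "as = cs @ t # ds" using split_list by metis
      then show False using inner[of cs t ds s bs] s sym[OF st(3)] out by simp
    next
      case 2
      then obtain cs ds where "bs = cs @ t # ds" using split_list by metis
      then show False using inner[of as s cs t ds] s st(3) out by simp
    qed
  qed
qed

section \<open>Translation to the library's digraphs\<close>

lemma (in pre_digraph) arcs_ends_induce:
  "arcs_ends (G \<restriction> W) = {(x, y). x \<rightarrow>\<^bsub>G\<^esub> y \<and> x \<in> W \<and> y \<in> W}"
proof (intro set_eqI)
  fix p
  show "p \<in> arcs_ends (G \<restriction> W) \<longleftrightarrow> p \<in> {(x, y). x \<rightarrow>\<^bsub>G\<^esub> y \<and> x \<in> W \<and> y \<in> W}"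
    by (cases p) (simp add: arcs_ends_def arc_to_ends_def induce_subgraph_def image_iff, blast)
qed

text \<open>Membership of x in \<open>W\<close> is stated apart because \<open>reach_in\<close> is
  reflexive everywhere, the library's reachability only on the vertex set.\<close>

lemma (in pre_digraph) reachable_induce:
  "x \<rightarrow>\<^sup>*\<^bsub>G \<restriction> W\<^esub> y \<longleftrightarrow> x \<in> W \<and> reach_in (\<lambda>x y. x \<rightarrow>\<^bsub>G\<^esub> y) W x y"
proof
  assume "x \<rightarrow>\<^sup>*\<^bsub>G \<restriction> W\<^esub> y"
  then have "(x, y) \<in> rtrancl_on W {(x, y). x \<rightarrow>\<^bsub>G\<^esub> y \<and> x \<in> W \<and> y \<in> W}"
    by (simp add: reachable_def arcs_ends_induce)
  then show "x \<in> W \<and> reach_in (\<lambda>x y. x \<rightarrow>\<^bsub>G\<^esub> y) W x y"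
  proof (induction rule: rtrancl_on_induct)
    case (step y z)
    then show ?case using reach_in_step[of "\<lambda>x y. x \<rightarrow>\<^bsub>G\<^esub> y" W x y z] by auto
  qed simp
next
  assume a: "x \<in> W \<and> reach_in (\<lambda>x y. x \<rightarrow>\<^bsub>G\<^esub> y) W x y"
  then have "reach_in (\<lambda>x y. x \<rightarrow>\<^bsub>G\<^esub> y) W x y" by simp
  then have "(x, y) \<in> rtrancl_on W {(x, y). x \<rightarrow>\<^bsub>G\<^esub> y \<and> x \<in> W \<and> y \<in> W}"
  proof (induction rule: reach_in_induct)
    case refl
    then show ?case using a by (simp add: rtrancl_on_refl)
  next
    case (step y z)
    then show ?case by (intro rtrancl_on_into_rtrancl_on[of x y W _ z]) auto
  qed
  then show "x \<rightarrow>\<^sup>*\<^bsub>G \<restriction> W\<^esub> y" by (simp add: reachable_def arcs_ends_induce)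
qed

lemma max_cliques_eq: "max_cliques G = maxcl (\<lambda>x y. x \<rightarrow>\<^bsub>G\<^esub> y) (verts G)"
proof -
  have clique: "is_clique G K \<longleftrightarrow> K \<subseteq> verts G \<and> pairwise (\<lambda>x y. x \<rightarrow>\<^bsub>G\<^esub> y) K" for K
    by (simp add: is_clique_def pairwise_def)
  show ?thesis unfolding max_cliques_def maxcl_def clique by (rule Collect_cong) blast
qed

lemma endpoint_with_proj:
  assumes "X \<in> F" "\<And>Z. (X, Z) \<in> P \<longleftrightarrow> Z = Y"
  shows "endpoint (with_proj \<lparr>pverts = F, parcs = P\<rparr>) X"
proof -
  have "out_arcs (with_proj \<lparr>pverts = F, parcs = P\<rparr>) X = {(X, Y)}"
    unfolding out_arcs_def by (intro set_eqI) (simp add: assms(2) prod_eq_iff split: prod.split, metis assms(2) prod.collapse)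
  then show ?thesis using assms(1) by (simp add: endpoint_def out_degree_def)
qed

lemma successively_with_proj:
  assumes "pcas u p v" "set p \<subseteq> P"
  shows "successively (\<lambda>x y. (x, y) \<in> P) (pawalk_verts u p)"
  using assms
proof (induction p arbitrary: u)
  case (Cons e p)
  then show ?case by (cases e; cases p) (auto simp: successively_Cons)
qed simp

lemma clique_tree_of_join_tree:
  assumes "join_tree (max_cliques G) P"
  shows "clique_tree G (with_proj \<lparr>pverts = max_cliques G, parcs = P\<rparr>)" (is "clique_tree G ?T")
proof -
  let ?F = "max_cliques G"
  interpret T: pair_graph "\<lparr>pverts = ?F, parcs = P\<rparr>"
    using join_tree_finite[OF assms] join_tree_sym[OF assms]
    by unfold_locales (auto simp: symmetric_def dest: join_tree_arcs_verts[OF assms])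
  have gr: "graph ?T" by (rule T.pair_graphD_graph)
  have walk: "successively (\<lambda>x y. (x, y) \<in> P) (pawalk_verts u p)"
    "hd (pawalk_verts u p) = u" "last (pawalk_verts u p) = v" "set (pawalk_verts u p) \<subseteq> ?F"
    if "T.awalk u p v" for u p v
    using that successively_with_proj[of u p v P] T.awalk_verts_in_verts[of u p] by auto
  have "X \<rightarrow>\<^sup>*\<^bsub>?T\<^esub> Y" if "X \<in> ?F" "Y \<in> ?F" for X Y
    using join_tree_connected[OF assms that]
  proof (induction rule: rtrancl_induct)
    case base
    then show ?case using that by simp
  next
    case (step Y Z)
    then show ?case using T.reachable_adj_trans[of X Y Z] by simp
  qed
  then have con: "Digraph_Component.connected ?T"
    using join_tree_finite[OF assms] by (intro T.connectedI T.reachable_mk_symmetricI) auto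
  have "False" if cyc: "pre_digraph.cycle ?T p" "3 \<le> length p" for p
  proof -
    obtain u where u: "T.awalk u p u" "distinct (tl (pawalk_verts u p))" "p \<noteq> []"
      using cyc(1) unfolding T.cycle_def by auto
    \<comment> \<open>The closed walk lists u at both ends. Without the first copy the vertices are
      distinct, and the closing arc starts at u.\<close>
    let ?xs = "tl (pawalk_verts u p)"
    have len: "length ?xs = length p" using T.length_awalk_verts[of u p] by simp
    have pv: "pawalk_verts u p = u # ?xs" using walk(2)[OF u(1)] by (cases p) auto
    have ne: "?xs \<noteq> []" using len u(3) by (metis length_0_conv)
    have suc: "successively (\<lambda>x y. (x, y) \<in> P) (u # ?xs)" using walk(1)[OF u(1)] pv by simp
    have "last ?xs = u" using walk(3)[OF u(1)] pv ne by (metis last_ConsR)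
    then have "(last ?xs, hd ?xs) \<in> P" using suc ne by (simp add: successively_Cons)
    moreover have "successively (\<lambda>x y. (x, y) \<in> P) ?xs" using suc ne by (simp add: successively_Cons)
    ultimately show False
      using join_tree_no_cycle[OF assms, of ?xs] u(2) cyc(2) len by simp
  qed
  moreover have "C1 \<inter> C2 \<subseteq> C3"
    if "pre_digraph.apath ?T C1 p C2" "C3 \<in> set (pre_digraph.awalk_verts ?T C1 p)" for C1 C2 C3 p
    using that join_tree_path[OF assms, of "pawalk_verts C1 p" C3] walk[of C1 p C2]
    by (auto simp: T.apath_def awalk_verts_with_proj_eq)
  ultimately show ?thesis
    using gr con unfolding clique_tree_def undirected_tree_def by auto
qed

section \<open>Separators and simply separated cliques\<close>

context graph
begin

interpretation adjacency "\<lambda>x y. x \<rightarrow>\<^bsub>G\<^esub> y" by (rule adjacency)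

lemma adj_verts: "x \<rightarrow>\<^bsub>G\<^esub> y \<Longrightarrow> x \<in> verts G \<and> y \<in> verts G"
  by (rule conjI) (auto elim: adj_in_verts)

lemma separates_iff:
  "separates G S a b \<longleftrightarrow> S \<subseteq> verts G \<and> a \<in> verts G - S \<and> b \<in> verts G - S \<and>
     \<not> reach_in (\<lambda>x y. x \<rightarrow>\<^bsub>G\<^esub> y) (verts G - S) a b"
  unfolding separates_def reachable_induce by blast

text \<open>Among the finitely many subsets of \<open>T\<close> that separate the same pair, an
  inclusion-minimal one is chosen.\<close>

lemma min_vertex_separator_subset:
  assumes "separates G T a b" "\<not> a \<rightarrow>\<^bsub>G\<^esub> b"
  obtains S where "S \<in> min_vertex_separators G" "S \<subseteq> T"
proof -
  have ab: "T \<subseteq> verts G" "a \<in> verts G - T" "b \<in> verts G - T" "a \<noteq> b"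
    using assms(1) unfolding separates_iff by auto
  have "finite {S. S \<subseteq> T \<and> separates G S a b}"
    using ab(1) finite_verts by (simp add: finite_subset)
  moreover have "T \<in> {S. S \<subseteq> T \<and> separates G S a b}" using assms(1) by simp
  ultimately obtain S where S: "S \<in> {S. S \<subseteq> T \<and> separates G S a b}" "S \<subseteq> T"
    and min: "\<forall>R\<in>{S. S \<subseteq> T \<and> separates G S a b}. R \<subseteq> S \<longrightarrow> S = R"
    using finite_has_minimal2[of "{S. S \<subseteq> T \<and> separates G S a b}" T] by blast
  have "\<not> separates G R a b" if "R \<subset> S" for R using that min S(2) by blast
  moreover have "S \<subset> verts G" "a \<in> verts G" "b \<in> verts G" using S(2) ab by blast+
  ultimately have "S \<in> min_vertex_separators G"
    using ab(4) assms(2) S(1) unfolding min_vertex_separators_def by blast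
  then show thesis using that S(2) by blast
qed

text \<open>The closed neighbourhood of a simplicial vertex a is a clique containing every clique
  through a, so it equals \<open>C\<close>.\<close>

lemma Simp_neighbours:
  assumes "C \<in> max_cliques G" "a \<in> Simp G C" "a \<rightarrow>\<^bsub>G\<^esub> x"
  shows "x \<in> C"
proof -
  have C: "C \<in> maxcl (\<lambda>x y. x \<rightarrow>\<^bsub>G\<^esub> y) (verts G)" using assms(1) by (simp add: max_cliques_eq)
  have a: "a \<in> C" "pairwise (\<lambda>x y. x \<rightarrow>\<^bsub>G\<^esub> y) {u. a \<rightarrow>\<^bsub>G\<^esub> u}"
    using assms(2) by (auto simp: Simp_def simplicial_def is_clique_def pairwise_def)
  let ?K = "insert a {u. a \<rightarrow>\<^bsub>G\<^esub> u}"
  have "?K = C"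
  proof (rule maxcl_maximal[OF C])
    show "?K \<subseteq> verts G" using adj_verts maxcl_clique(2)[OF C] a(1) by blast
    show "pairwise (\<lambda>x y. x \<rightarrow>\<^bsub>G\<^esub> y) ?K" using a(2) sym[of a] by (simp add: pairwise_insert)
    show "C \<subseteq> ?K" using maxcl_clique(1)[OF C] a(1) by (auto simp: pairwise_def)
  qed
  then show ?thesis using assms(3) by blast
qed

lemma Simp_unique:
  assumes "C \<in> max_cliques G" "D \<in> max_cliques G" "a \<in> Simp G C" "a \<in> D"
  shows "D = C"
proof -
  have C: "C \<in> maxcl (\<lambda>x y. x \<rightarrow>\<^bsub>G\<^esub> y) (verts G)" and D: "D \<in> maxcl (\<lambda>x y. x \<rightarrow>\<^bsub>G\<^esub> y) (verts G)"
    using assms(1,2) by (simp_all add: max_cliques_eq)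
  have "x \<in> C" if "x \<in> D" for x
  proof (cases "x = a")
    case True
    then show ?thesis using assms(3) by (simp add: Simp_def)
  next
    case False
    then have "a \<rightarrow>\<^bsub>G\<^esub> x" using maxcl_clique(1)[OF D] assms(4) that by (simp add: pairwise_def)
    then show ?thesis by (rule Simp_neighbours[OF assms(1,3)])
  qed
  then have "C = D" using maxcl_maximal[OF D] maxcl_clique[OF C] by blast
  then show ?thesis ..
qed

lemma in_Sep:
  assumes "C \<in> max_cliques G" "D \<in> max_cliques G" "D \<noteq> C" "x \<in> C" "x \<in> D"
  shows "x \<in> Sep G C"
  using assms Simp_unique[OF assms(1,2)] by (auto simp: Sep_def)

lemma simply_separatedE:
  assumes "simply_separated G C"
  obtains a B where "C \<in> max_cliques G" "a \<in> Simp G C" "B \<in> max_cliques G" "B \<noteq> C" "Sep G C = C \<inter> B"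
proof -
  obtain a B where "C \<in> max_cliques G" "a \<in> Simp G C" "B \<in> max_cliques G" "Sep G C = C \<inter> B"
    using assms unfolding simply_separated_def by blast
  moreover from this have "B \<noteq> C" by (auto simp: Sep_def Simp_def)
  ultimately show thesis using that by blast
qed

text \<open>Without \<open>Sep G C\<close> only simplicial vertices of \<open>C\<close> remain in
  \<open>C\<close>, and no walk from a gets past them. Each common vertex is adjacent to both a and
  b, so none can be spared.\<close>

lemma Inter_is_min_vertex_separator:
  assumes C: "C \<in> max_cliques G" "a \<in> Simp G C" and C': "C' \<in> max_cliques G" "b \<in> Simp G C'"
    and "C \<noteq> C'" "Sep G C = C \<inter> C'"
  shows "C \<inter> C' \<in> min_vertex_separators G"
proof -
  have mem: "a \<in> C" "b \<in> C'" using C C' by (auto simp: Simp_def)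
  have notin: "a \<notin> C'" "b \<notin> C" using Simp_unique assms(1-5) by metis+
  have cl: "C \<subseteq> verts G" "C' \<subseteq> verts G" "pairwise (\<lambda>x y. x \<rightarrow>\<^bsub>G\<^esub> y) C" "pairwise (\<lambda>x y. x \<rightarrow>\<^bsub>G\<^esub> y) C'"
    using C C' maxcl_clique unfolding max_cliques_eq by blast+
  have "z \<in> Simp G C" if "reach_in (\<lambda>x y. x \<rightarrow>\<^bsub>G\<^esub> y) (verts G - C \<inter> C') a z" for z
    using that
  proof (induction rule: reach_in_induct)
    case refl
    show ?case by (rule C(2))
  next
    case (step y z)
    have "z \<in> C" using Simp_neighbours[OF C(1)] step by blast
    then show ?case using step.hyps(4) assms(6) by (auto simp: Sep_def)
  qed
  then have "\<not> reach_in (\<lambda>x y. x \<rightarrow>\<^bsub>G\<^esub> y) (verts G - C \<inter> C') a b"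
    using notin by (auto simp: Simp_def)
  then have sep: "separates G (C \<inter> C') a b"
    using mem notin cl unfolding separates_iff by blast
  have "\<not> separates G R a b" if R: "R \<subset> C \<inter> C'" for R
  proof -
    obtain s where s: "s \<in> C \<inter> C'" "s \<notin> R" using R by blast
    have "a \<rightarrow>\<^bsub>G\<^esub> s" "s \<rightarrow>\<^bsub>G\<^esub> b" using s mem notin cl(3,4) by (metis IntD1 IntD2 pairwiseD)+
    moreover have "a \<in> verts G - R" "b \<in> verts G - R" "s \<in> verts G - R"
      using s mem notin cl R by blast+
    ultimately have "reach_in (\<lambda>x y. x \<rightarrow>\<^bsub>G\<^esub> y) (verts G - R) a b"
      by (metis reach_in_edge reach_in_step)
    then show ?thesis by (simp add: separates_iff)
  qed
  moreover have "\<not> a \<rightarrow>\<^bsub>G\<^esub> b" using Simp_neighbours[OF C] notin by blast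
  moreover have "C \<inter> C' \<subset> verts G" "a \<in> verts G" "b \<in> verts G" "a \<noteq> b" using cl mem notin by blast+
  ultimately show ?thesis using sep unfolding min_vertex_separators_def by blast
qed

text \<open>This yields a node to hang \<open>C\<close> on that differs from \<open>C'\<close>, so
  that \<open>C'\<close> can stay a leaf.\<close>

lemma third_clique:
  assumes "chordal G" and CC': "simply_separated G C" "simply_separated G C'" "C \<noteq> C'"
    and D: "D \<in> max_cliques G" "D \<noteq> C" "D \<noteq> C'"
    and S: "\<forall>S'\<in>min_vertex_separators G. \<not> S' \<subset> S" "C \<inter> C' \<subseteq> S"
  obtains B where "B \<in> max_cliques G" "B \<noteq> C" "B \<noteq> C'" "Sep G C \<subseteq> B"
proof -
  let ?E = "\<lambda>x y. x \<rightarrow>\<^bsub>G\<^esub> y"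
  obtain a B where C: "C \<in> max_cliques G" "a \<in> Simp G C"
    and B: "B \<in> max_cliques G" "B \<noteq> C" "Sep G C = C \<inter> B"
    using simply_separatedE[OF CC'(1)] by metis
  obtain b B' where C': "C' \<in> max_cliques G" "b \<in> Simp G C'"
    and B': "B' \<in> max_cliques G" "B' \<noteq> C'" "Sep G C' = C' \<inter> B'"
    using simply_separatedE[OF CC'(2)] by metis
  consider "B \<noteq> C'" | "B = C'" "B' \<noteq> C" | "B = C'" "B' = C" by blast
  then show thesis
  proof cases
    case 1
    then show thesis using that[of B] B by blast
  next
    case 2
    have "C \<inter> C' \<subseteq> Sep G C'" using in_Sep[OF C'(1) C(1) CC'(3)] by blast
    then have "Sep G C \<subseteq> B'" using B(3) B'(3) 2 by blast
    then show thesis using that[of B'] B' 2 by blast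
  next
    case 3
    define Z where "Z = C \<inter> C'"
    have Sep: "Sep G C = Z" "Sep G C' = Z" using 3 B(3) B'(3) by (auto simp: Z_def)
    have aC: "a \<in> C" "a \<notin> C'" using C Simp_unique[OF C(1) C'(1) C(2)] CC'(3) by (auto simp: Simp_def)
    have "Z \<in> min_vertex_separators G"
      unfolding Z_def using C C' CC'(3) Sep(1)[unfolded Z_def] by (rule Inter_is_min_vertex_separator)
    \<comment> \<open>\<open>Z\<close> is a minimal vertex separator inside \<open>S\<close>, and
      none lies properly inside \<open>S\<close>.\<close>
    then have "Z = S" using S by (auto simp: Z_def)
    then have min: "\<not> T \<subset> Z" if "T \<in> min_vertex_separators G" for T using S(1) that by blast
    have cl: "C \<in> maxcl ?E (verts G)" "C' \<in> maxcl ?E (verts G)" "D \<in> maxcl ?E (verts G)"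
      using C(1) C'(1) D(1) by (simp_all add: max_cliques_eq)
    \<comment> \<open>Vertices that \<open>D\<close> shares with \<open>C'\<close> lie in
      \<open>Sep G C' = Z\<close>, hence in \<open>C\<close>; so \<open>D\<close> would be contained
      in \<open>C\<close>.\<close>
    have "\<not> D \<subseteq> C \<union> C'"
    proof
      assume "D \<subseteq> C \<union> C'"
      then have "D \<subseteq> C"
        using in_Sep[OF C'(1) D(1,3)] Sep(2) unfolding Z_def by blast
      then have "C = D" using maxcl_maximal[OF cl(3)] maxcl_clique[OF cl(1)] by blast
      then show False using D by simp
    qed
    then obtain d where d: "d \<in> D" "d \<notin> C" "d \<notin> C'" by blast
    have dV: "d \<in> verts G - Z" using d maxcl_clique(2)[OF cl(3)] by (auto simp: Z_def)
    define \<Gamma> where "\<Gamma> = {z. reach_in ?E (verts G - Z) d z}"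
    have \<Gamma>V: "\<Gamma> \<subseteq> verts G - Z" unfolding \<Gamma>_def using reach_in_mem dV by fast
    have \<Gamma>_conn: "reach_in ?E (insert s \<Gamma>) d y" if "y \<in> \<Gamma>" for s y
    proof (rule reach_in_mono)
      show "reach_in ?E \<Gamma> d y"
        using that reach_in_closed[of ?E "verts G - Z" d y] by (simp add: \<Gamma>_def)
    qed blast
    \<comment> \<open>Outside \<open>Z\<close> the clique \<open>K\<close> has only simplicial
      vertices, whose neighbours are already in \<open>K\<close>; no walk enters from
      outside.\<close>
    have avoid: "z \<notin> K"
      if K: "K \<in> max_cliques G" "Sep G K = Z" "d \<notin> K" and z: "reach_in ?E (verts G - Z) d z" for K z
      using z
    proof (induction rule: reach_in_induct)
      case refl
      show ?case by (rule K(3))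
    next
      case (step y z)
      show ?case
      proof
        assume "z \<in> K"
        then have "z \<in> Simp G K" using step.hyps(4) K(2) by (auto simp: Sep_def)
        then have "y \<in> K" using Simp_neighbours[OF K(1)] sym[OF step.hyps(2)] by blast
        then show False using step by blast
      qed
    qed
    have \<Gamma>C: "z \<notin> C \<and> z \<notin> C'" if "z \<in> \<Gamma>" for z
      using that avoid[OF C(1) Sep(1) d(2)] avoid[OF C'(1) Sep(2) d(3)] by (simp add: \<Gamma>_def)
    \<comment> \<open>Once s is put back, d and a are connected, since otherwise
      \<open>Z - {s}\<close> would contain a minimal vertex separator properly inside
      \<open>Z\<close>. Such a walk first leaves \<Gamma> at s.\<close>
    have reach: "reach_in ?E (insert s \<Gamma>) x s" if x: "x \<in> \<Gamma>" and s: "s \<in> Z" for x s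
    proof -
      let ?W = "verts G - (Z - {s})"
      have "reach_in ?E ?W d a"
      proof (rule ccontr)
        assume "\<not> ?thesis"
        moreover have "Z - {s} \<subseteq> verts G" "a \<in> ?W" "d \<in> ?W"
          using aC dV maxcl_clique(2)[OF cl(1)] by (auto simp: Z_def)
        ultimately have "separates G (Z - {s}) d a" by (simp add: separates_iff)
        moreover have "\<not> d \<rightarrow>\<^bsub>G\<^esub> a" using Simp_neighbours[OF C] sym d(2) by blast
        ultimately obtain T where "T \<in> min_vertex_separators G" "T \<subseteq> Z - {s}"
          using min_vertex_separator_subset by metis
        then show False using min s by blast
      qed
      moreover have "z \<in> \<Gamma> \<or> reach_in ?E (insert s \<Gamma>) d s" if "reach_in ?E ?W d z" for z
        using that
      proof (induction rule: reach_in_induct)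
        case refl
        show ?case by (simp add: \<Gamma>_def)
      next
        case (step y z)
        show ?case
        proof (cases "y \<in> \<Gamma>")
          case y: True
          show ?thesis
          proof (cases "z = s")
            case True
            then show ?thesis
              using y step.hyps(2) reach_in_step[OF \<Gamma>_conn[OF y], of s s] by simp
          next
            case False
            then have "z \<in> verts G - Z" using step.hyps(4) by blast
            moreover have "y \<in> verts G - Z" using y \<Gamma>V by blast
            ultimately show ?thesis
              using y step.hyps(2) reach_in_step[of ?E "verts G - Z" d y z] by (simp add: \<Gamma>_def)
          qed
        next
          case False
          then show ?thesis using step by blast
        qed
      qed
      ultimately have "reach_in ?E (insert s \<Gamma>) d s" using \<Gamma>C aC(1) by blast
      moreover have "reach_in ?E (insert s \<Gamma>) x d" using \<Gamma>_conn[OF x] by (rule reach_in_sym)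
      ultimately show ?thesis by (rule reach_in_trans[rotated])
    qed
    have ZV: "Z \<subseteq> verts G" using maxcl_clique(2)[OF cl(1)] by (auto simp: Z_def)
    have fin: "finite \<Gamma>" "finite Z"
      using \<Gamma>V ZV finite_verts by (meson Diff_subset finite_subset)+
    have "d \<in> \<Gamma>" by (simp add: \<Gamma>_def)
    then have ne: "\<Gamma> \<noteq> {}" by blast
    \<comment> \<open>The simplicial vertex a plays the role of c in \<open>full_vertex\<close>:
      adjacent to all of \<open>Z\<close>, to nothing in \<Gamma>.\<close>
    have "hole_free ?E (insert a (Z \<union> \<Gamma>))"
      using hole_free_of_chordal[OF assms(1)]
      by (rule hole_free_subset) (use \<Gamma>V ZV aC maxcl_clique(2)[OF cl(1)] in blast)
    moreover have "a \<rightarrow>\<^bsub>G\<^esub> z" if "z \<in> Z" for z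
      using that aC maxcl_clique(1)[OF cl(1)] by (auto simp: Z_def pairwise_def)
    moreover have "z \<noteq> a \<and> \<not> a \<rightarrow>\<^bsub>G\<^esub> z" if "z \<in> \<Gamma>" for z
      using \<Gamma>C[OF that] aC Simp_neighbours[OF C] by blast
    ultimately obtain w where w: "w \<in> \<Gamma>" "\<And>s. s \<in> Z \<Longrightarrow> w \<rightarrow>\<^bsub>G\<^esub> s"
      using full_vertex[OF fin ne, of a] reach by blast
    \<comment> \<open>A maximal clique around \<open>insert w Z\<close> contains
      \<open>Sep G C\<close>, and w keeps it apart from \<open>C\<close> and
      \<open>C'\<close>.\<close>
    have "pairwise ?E Z" using maxcl_clique(1)[OF cl(1)] by (auto simp: Z_def pairwise_def)
    then have "pairwise ?E (insert w Z)" using w(2) sym[of w] by (simp add: pairwise_insert)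
    moreover have "insert w Z \<subseteq> verts G"
      using w(1) \<Gamma>V ZV by blast
    ultimately obtain K where "K \<in> maxcl ?E (verts G)" "insert w Z \<subseteq> K"
      using clique_in_maxcl[OF finite_verts, of "insert w Z" ?E] by blast
    then show thesis using that[of K] \<Gamma>C[OF w(1)] Sep(1) unfolding max_cliques_eq by blast
  qed
qed

section \<open>Clique trees with prescribed endpoints\<close>

lemma delete_leaf_clique:
  assumes "C \<in> max_cliques G" "B \<in> max_cliques G" "B \<noteq> C" "Sep G C \<subseteq> B"
  shows "C \<inter> \<Union>(max_cliques G - {C}) \<subseteq> B"
    and "maxcl (\<lambda>x y. x \<rightarrow>\<^bsub>G\<^esub> y) (\<Union>(max_cliques G - {C})) = max_cliques G - {C}"
proof -
  show *: "C \<inter> \<Union>(max_cliques G - {C}) \<subseteq> B" using in_Sep[OF assms(1)] assms(4) by blast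
  show "maxcl (\<lambda>x y. x \<rightarrow>\<^bsub>G\<^esub> y) (\<Union>(max_cliques G - {C})) = max_cliques G - {C}"
    using maxcl_delete_leaf[OF finite_verts, of C B] assms * unfolding max_cliques_eq by blast
qed

lemma join_tree_sub:
  assumes "chordal G" "verts G \<noteq> {}" "F \<subseteq> max_cliques G" "F \<noteq> {}"
    "maxcl (\<lambda>x y. x \<rightarrow>\<^bsub>G\<^esub> y) (\<Union>F) = F"
  obtains P where "join_tree F P"
proof -
  have sub: "\<Union>F \<subseteq> verts G" using assms(3) maxcl_clique(2) unfolding max_cliques_eq by blast
  \<comment> \<open>Otherwise the empty set would be a maximal clique of a graph that has a
    vertex.\<close>
  have "\<Union>F \<noteq> {}"
  proof
    assume e: "\<Union>F = {}"
    obtain B where "B \<in> max_cliques G" "B = {}" using assms(3,4) e by blast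
    moreover obtain v where "v \<in> verts G" using assms(2) by blast
    ultimately show False
      using maxcl_maximal[of "{}" "\<lambda>x y. x \<rightarrow>\<^bsub>G\<^esub> y" "verts G" "{v}"] unfolding max_cliques_eq by simp
  qed
  then have "\<exists>P. join_tree (maxcl (\<lambda>x y. x \<rightarrow>\<^bsub>G\<^esub> y) (\<Union>F)) P"
    using join_tree_maxcl[OF finite_subset[OF sub finite_verts] hole_free_subset[OF hole_free_of_chordal[OF assms(1)] sub]]
    by blast
  then show thesis using that assms(5) by auto
qed

lemma clique_tree_one_endpoint:
  assumes "chordal G" "verts G \<noteq> {}" "simply_separated G C"
  shows "\<exists>T :: 'a set pair_pre_digraph. clique_tree G (with_proj T) \<and> endpoint (with_proj T) C"
proof -
  obtain B where C: "C \<in> max_cliques G" and B: "B \<in> max_cliques G" "B \<noteq> C" "Sep G C \<subseteq> B"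
    using simply_separatedE[OF assms(3)] by (metis Int_lower2)
  let ?F = "max_cliques G - {C}"
  note leaf = delete_leaf_clique[OF C B]
  obtain P where P: "join_tree ?F P"
    using join_tree_sub[OF assms(1,2), of ?F] leaf(2) B by blast
  let ?P = "insert (B, C) (insert (C, B) P)"
  have "join_tree (insert C ?F) ?P"
    using P leaf(1) B by (intro join_tree.attach) auto
  then have jt: "join_tree (max_cliques G) ?P" using C by (simp add: insert_absorb)
  have "(C, Z) \<in> ?P \<longleftrightarrow> Z = B" for Z
    using join_tree_arcs_verts[OF P, of C Z] B(2) by auto
  then show ?thesis
    using clique_tree_of_join_tree[OF jt] endpoint_with_proj[OF C, of ?P B] by blast
qed

lemma clique_tree_two_endpoints:
  assumes "chordal G" "verts G \<noteq> {}" "simply_separated G C" "simply_separated G C'" "C \<noteq> C'"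
    and S: "\<forall>S'\<in>min_vertex_separators G. \<not> S' \<subset> S" "C \<inter> C' \<subseteq> S"
  shows "\<exists>T :: 'a set pair_pre_digraph.
    clique_tree G (with_proj T) \<and> endpoint (with_proj T) C \<and> endpoint (with_proj T) C'"
proof -
  have C: "C \<in> max_cliques G" "C' \<in> max_cliques G"
    using assms(3,4) by (auto simp: simply_separated_def)
  show ?thesis
  proof (cases "max_cliques G = {C, C'}")
    case True
    have "join_tree (insert C {C'}) (insert (C', C) (insert (C, C') {}))"
      using assms(5) by (intro join_tree.attach join_tree.single) auto
    then have jt: "join_tree (max_cliques G) {(C', C), (C, C')}" using True by simp
    show ?thesis
      using clique_tree_of_join_tree[OF jt] endpoint_with_proj[OF C(1), of "{(C', C), (C, C')}" C']
        endpoint_with_proj[OF C(2), of "{(C', C), (C, C')}" C] assms(5) by auto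
  next
    case False
    then obtain D where D: "D \<in> max_cliques G" "D \<noteq> C" "D \<noteq> C'" using C by blast
    obtain B where B: "B \<in> max_cliques G" "B \<noteq> C" "B \<noteq> C'" "Sep G C \<subseteq> B"
      using third_clique[OF assms(1,3,4,5) D S] by metis
    obtain B' where B': "B' \<in> max_cliques G" "B' \<noteq> C'" "B' \<noteq> C" "Sep G C' \<subseteq> B'"
      using third_clique[OF assms(1,4,3) assms(5)[symmetric] D(1,3,2) S(1)] S(2)
      by (metis Int_commute)
    let ?F = "max_cliques G - {C}" and ?F' = "max_cliques G - {C, C'}"
    have F': "?F - {C'} = ?F'" by auto
    note leaf = delete_leaf_clique[OF C(1) B(1,2,4)]
    have leaf': "C' \<inter> \<Union>?F' \<subseteq> B'" using delete_leaf_clique(1)[OF C(2) B'(1,2,4)] by blast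
    \<comment> \<open>\<open>C'\<close> is deleted second, from the graph spanned by the cliques
      other than \<open>C\<close>; its partner \<open>B'\<close> survives since it is not
      \<open>C\<close>.\<close>
    have "finite (\<Union>?F)"
      using maxcl_clique(2) finite_verts unfolding max_cliques_eq
      by (metis (no_types, lifting) DiffE Sup_least finite_subset)
    then have "maxcl (\<lambda>x y. x \<rightarrow>\<^bsub>G\<^esub> y) (\<Union>?F') = ?F'"
      using maxcl_delete_leaf[of "\<Union>?F" C' B'] leaf(2) leaf' F' B' C(2) assms(5)
      by auto
    then obtain P where P: "join_tree ?F' P"
      using join_tree_sub[OF assms(1,2), of ?F'] D by blast
    let ?P = "insert (B', C') (insert (C', B') P)"
    have "join_tree (insert C' ?F') ?P"
      using P leaf' B' by (intro join_tree.attach) auto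
    moreover have "insert C' ?F' = ?F" using C assms(5) by auto
    ultimately have P': "join_tree ?F ?P" by simp
    let ?Q = "insert (B, C) (insert (C, B) ?P)"
    have "join_tree (insert C ?F) ?Q"
      using P' leaf(1) B by (intro join_tree.attach) auto
    then have jt: "join_tree (max_cliques G) ?Q" using C by (simp add: insert_absorb)
    have "(C, Z) \<in> ?Q \<longleftrightarrow> Z = B" for Z
      using join_tree_arcs_verts[OF P', of C Z] B(2) by auto
    \<comment> \<open>\<open>C\<close> was attached to \<open>B\<close>, which is not
      \<open>C'\<close>, so \<open>C'\<close> keeps its single arc.\<close>
    moreover have "(C', Z) \<in> ?Q \<longleftrightarrow> Z = B'" for Z
      using join_tree_arcs_verts[OF P, of C' Z] B(3) B'(2) assms(5) by auto
    ultimately show ?thesis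
      using clique_tree_of_join_tree[OF jt] endpoint_with_proj[OF C(1), of ?Q B]
        endpoint_with_proj[OF C(2), of ?Q B'] by blast
  qed
qed

end

theorem theorem3p1:
  fixes G :: "('a,'b) pre_digraph"
  assumes "graph G" and "Digraph_Component.connected G" and "chordal G"
  shows "(\<forall>C. simply_separated G C \<longrightarrow>
            (\<exists>T :: 'a set pair_pre_digraph.
               clique_tree G (with_proj T) \<and> endpoint (with_proj T) C)) \<and>
         (\<forall>S \<in> min_vertex_separators G.
            (\<forall>S' \<in> min_vertex_separators G. \<not> S' \<subset> S) \<longrightarrow>
            (\<forall>C C' \<Gamma> \<Gamma>'.
               simply_separated G C \<and> simply_separated G C' \<and>
               \<Gamma> \<in> component_verts (G \<restriction> (verts G - S)) \<and>
               \<Gamma>' \<in> component_verts (G \<restriction> (verts G - S)) \<and> \<Gamma> \<noteq> \<Gamma>' \<and>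
               C - S \<subseteq> \<Gamma> \<and> C' - S \<subseteq> \<Gamma>' \<longrightarrow>
               (\<exists>T :: 'a set pair_pre_digraph.
                  clique_tree G (with_proj T) \<and>
                  endpoint (with_proj T) C \<and> endpoint (with_proj T) C')))"
proof (intro conjI allI impI ballI)
  interpret graph G by (rule assms(1))
  have ne: "verts G \<noteq> {}"
    using assms(2) by (auto simp: Digraph_Component.connected_def strongly_connected_def)
  show "\<exists>T :: 'a set pair_pre_digraph. clique_tree G (with_proj T) \<and> endpoint (with_proj T) C"
    if "simply_separated G C" for C
    using that by (rule clique_tree_one_endpoint[OF assms(3) ne])
  fix S C C' \<Gamma> \<Gamma>'
  assume min: "\<forall>S' \<in> min_vertex_separators G. \<not> S' \<subset> S"
    and *: "simply_separated G C \<and> simply_separated G C' \<and>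
      \<Gamma> \<in> component_verts (G \<restriction> (verts G - S)) \<and>
      \<Gamma>' \<in> component_verts (G \<restriction> (verts G - S)) \<and> \<Gamma> \<noteq> \<Gamma>' \<and>
      C - S \<subseteq> \<Gamma> \<and> C' - S \<subseteq> \<Gamma>'"
  then have CC': "simply_separated G C" "simply_separated G C'"
    and comp: "\<Gamma> \<in> component_verts (G \<restriction> (verts G - S))"
      "\<Gamma>' \<in> component_verts (G \<restriction> (verts G - S))" "\<Gamma> \<noteq> \<Gamma>'" "C - S \<subseteq> \<Gamma>" "C' - S \<subseteq> \<Gamma>'"
    by blast+
  have "wf_digraph (G \<restriction> (verts G - S))" by unfold_locales (auto)
  then have "\<Gamma> \<inter> \<Gamma>' = {}"
    using comp(1-3) unfolding component_verts_def by (rule wf_digraph.sccs_verts_disjoint)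
  \<comment> \<open>A common vertex outside \<open>S\<close> would lie in two disjoint
    components.\<close>
  then have "C \<inter> C' \<subseteq> S" using comp(4,5) by blast
  then show "\<exists>T :: 'a set pair_pre_digraph. clique_tree G (with_proj T) \<and>
      endpoint (with_proj T) C \<and> endpoint (with_proj T) C'"
    \<comment> \<open>The cliques may coincide, namely when both lie in \<open>S\<close>-free parts
      vacuously; then one endpoint suffices.\<close>
    using clique_tree_two_endpoints[OF assms(3) ne CC' _ min] clique_tree_one_endpoint[OF assms(3) ne CC'(1)]
    by (cases "C = C'") auto
qed

end
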